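(* In LLFP (defined in the context), if a judgement $\Gamma\vdash_\Sigma\mathcal{U}^{\mathcal{P}}_{N,\sigma}[M]:\tau$ is derivable, then $\mathcal{P}(\Gamma\vdash_\Sigma N:\sigma)$ holds.
   Context: LLFP (Lax Logical Framework) is parametrized by a set of predicates $\mathcal{P}$ on typing judgements $\Gamma \vdash_\Sigma N:\sigma$. Pseudo-syntax: signatures $\Sigma ::= \emptyset \mid \Sigma, a:K \mid \Sigma, c:\sigma$; contexts $\Gamma ::= \emptyset \mid \Gamma, x:\sigma$; kinds $K ::= \mathrm{Type} \mid \Pi x{:}\sigma.K$; families $\sigma,\tau,\rho ::= a \mid \Pi x{:}\sigma.\tau \mid \sigma N \mid \mathcal{L}^{\mathcal{P}}_{N,\sigma}[\rho]$; objects $M,N ::= c \mid x \mid \lambda x{:}\sigma.M \mid M N \mid \mathcal{L}^{\mathcal{P}}_{N,\sigma}[M] \mid \mathcal{U}^{\mathcal{P}}_{N,\sigma}[M]$. One-step $\beta\mathcal{L}$-reduction $\to_{\beta\mathcal{L}}$ is the closure under all constructors of $(\lambda x{:}\sigma.M)N \to M[N/x]$ and $\mathcal{U}^{\mathcal{P}}_{N,\sigma}[\mathcal{L}^{\mathcal{P}}_{N,\sigma}[M]] \to M$; $=_{\beta\mathcal{L}}$ is its reflexive, symmetric, transitive closure. Judgements: $\Sigma\ \mathrm{sig}$, $\vdash_\Sigma \Gamma$, $\Gamma\vdash_\Sigma K$, $\Gamma\vdash_\Sigma \sigma:K$, $\Gamma\vdash_\Sigma M:\sigma$, derived by the rules: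 Signatures: $\emptyset\ \mathrm{sig}$; from $\vdash_\Sigma K$ and $a\notin\mathrm{Dom}(\Sigma)$ infer $\Sigma,a:K\ \mathrm{sig}$; from $\vdash_\Sigma\sigma:\mathrm{Type}$ and $c\notin\mathrm{Dom}(\Sigma)$ infer $\Sigma,c:\sigma\ \mathrm{sig}$. Contexts: from $\Sigma\ \mathrm{sig}$ infer $\vdash_\Sigma\emptyset$; from $\Gamma\vdash_\Sigma\sigma:\mathrm{Type}$ and $x\notin\mathrm{Dom}(\Gamma)$ infer $\vdash_\Sigma\Gamma,x:\sigma$. Kinds: from $\vdash_\Sigma\Gamma$ infer $\Gamma\vdash_\Sigma\mathrm{Type}$; from $\Gamma,x:\sigma\vdash_\Sigma K$ infer $\Gamma\vdash_\Sigma\Pi x{:}\sigma.K$. Families: from $\vdash_\Sigma\Gamma$, $a:K\in\Sigma$ infer $\Gamma\vdash_\Sigma a:K$; from $\Gamma,x:\sigma\vdash_\Sigma\tau:\mathrm{Type}$ infer $\Gamma\vdash_\Sigma\Pi x{:}\sigma.\tau:\mathrm{Type}$; from $\Gamma\vdash_\Sigma\sigma:\Pi x{:}\tau.K$ and $\Gamma\vdash_\Sigma N:\tau$ infer $\Gamma\vdash_\Sigma\sigma N:K[N/x]$; from $\Gamma\vdash_\Sigma\rho:\mathrm{Type}$ and $\Gamma\vdash_\Sigma N:\sigma$ infer $\Gamma\vdash_\Sigma\mathcal{L}^{\mathcal{P}}_{N,\sigma}[\rho]:\mathrm{Type}$; from $\Gamma\vdash_\Sigma\sigma:K$, $\Gamma\vdash_\Sigma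 K'$, $K=_{\beta\mathcal{L}}K'$ infer $\Gamma\vdash_\Sigma\sigma:K'$; (F-Guarded-Unlock) from $\Gamma,x:\tau\vdash_\Sigma\mathcal{L}^{\mathcal{P}}_{S,\sigma}[\rho]:\mathrm{Type}$, $\Gamma\vdash_\Sigma N:\mathcal{L}^{\mathcal{P}}_{S',\sigma'}[\tau]$, $\sigma=_{\beta\mathcal{L}}\sigma'$, $S=_{\beta\mathcal{L}}S'$ infer $\Gamma\vdash_\Sigma\mathcal{L}^{\mathcal{P}}_{S,\sigma}[\rho[\mathcal{U}^{\mathcal{P}}_{S',\sigma'}[N]/x]]:\mathrm{Type}$. Objects: from $\vdash_\Sigma\Gamma$, $c:\sigma\in\Sigma$ infer $\Gamma\vdash_\Sigma c:\sigma$; from $\vdash_\Sigma\Gamma$, $x:\sigma\in\Gamma$ infer $\Gamma\vdash_\Sigma x:\sigma$; from $\Gamma,x:\sigma\vdash_\Sigma M:\tau$ infer $\Gamma\vdash_\Sigma\lambda x{:}\sigma.M:\Pi x{:}\sigma.\tau$; from $\Gamma\vdash_\Sigma M:\Pi x{:}\sigma.\tau$ and $\Gamma\vdash_\Sigma N:\sigma$ infer $\Gamma\vdash_\Sigma MN:\tau[N/x]$; from $\Gamma\vdash_\Sigma M:\sigma$, $\Gamma\vdash_\Sigma\tau:\mathrm{Type}$, $\sigma=_{\beta\mathcal{L}}\tau$ infer $\Gamma\vdash_\Sigma M:\tau$; (O-Lock) from $\Gamma\vdash_\Sigma M:\rho$ and $\Gamma\vdash_\Sigma N:\sigma$ infer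 $\Gamma\vdash_\Sigma\mathcal{L}^{\mathcal{P}}_{N,\sigma}[M]:\mathcal{L}^{\mathcal{P}}_{N,\sigma}[\rho]$; (O-Top-Unlock) from $\Gamma\vdash_\Sigma M:\mathcal{L}^{\mathcal{P}}_{N,\sigma}[\rho]$ and the (externally decided) fact that $\mathcal{P}(\Gamma\vdash_\Sigma N:\sigma)$ holds, infer $\Gamma\vdash_\Sigma\mathcal{U}^{\mathcal{P}}_{N,\sigma}[M]:\rho$; (O-Guarded-Unlock) from $\Gamma,x:\tau\vdash_\Sigma\mathcal{L}^{\mathcal{P}}_{S,\sigma}[M]:\mathcal{L}^{\mathcal{P}}_{S,\sigma}[\rho]$, $\Gamma\vdash_\Sigma N:\mathcal{L}^{\mathcal{P}}_{S',\sigma'}[\tau]$, $\sigma=_{\beta\mathcal{L}}\sigma'$, $S=_{\beta\mathcal{L}}S'$ infer $\Gamma\vdash_\Sigma\mathcal{L}^{\mathcal{P}}_{S,\sigma}[M[\mathcal{U}^{\mathcal{P}}_{S',\sigma'}[N]/x]]:\mathcal{L}^{\mathcal{P}}_{S,\sigma}[\rho[\mathcal{U}^{\mathcal{P}}_{S',\sigma'}[N]/x]]$. *)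

theory Defs
  imports Main
begin

text \<open>
  Terms are taken up to alpha-conversion: bound variables are de Bruijn indices, while the
  variables declared in contexts keep their names.  The type parameter \<open>'p\<close> is the index set
  of the family of predicates; an index occurs in the syntax of locks and unlocks, and its meaning
  is given by an interpretation (type \<open>interp\<close> below).
\<close>

type_synonym name = string

datatype 'p fam =
    FConst name
  | FPi "'p fam" "'p fam"
  | FApp "'p fam" "'p obj"
  | FLock 'p "'p obj" "'p fam" "'p fam"
and 'p obj =
    OConst name
  | Free name
  | Bound nat
  | Lam "'p fam" "'p obj"
  | OApp "'p obj" "'p obj"
  | OLock 'p "'p obj" "'p fam" "'p obj"
  | OUnlock 'p "'p obj" "'p fam" "'p obj"

datatype 'p kind =
    Type
  | KPi "'p fam" "'p kind"

datatype 'p decl = FDecl name "'p kind" | ODecl name "'p fam"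

text \<open>Signatures and contexts are lists with the most recent declaration at the head.\<close>

type_synonym 'p sig = "'p decl list"
type_synonym 'p ctx = "(name \<times> 'p fam) list"

primrec decl_name :: "'p decl \<Rightarrow> name" where
  "decl_name (FDecl a K) = a"
| "decl_name (ODecl c \<sigma>) = c"

definition sig_dom :: "'p sig \<Rightarrow> name set" where
  "sig_dom \<Sigma> = decl_name ` set \<Sigma>"

definition ctx_dom :: "'p ctx \<Rightarrow> name set" where
  "ctx_dom \<Gamma> = fst ` set \<Gamma>"

text \<open>\<open>I P \<Sigma> \<Gamma> N \<sigma>\<close> says that the predicate with index \<open>P\<close> holds of the judgement
  \<open>\<Gamma> \<turnstile>\<^sub>\<Sigma> N : \<sigma>\<close>.\<close>

type_synonym 'p interp = "'p \<Rightarrow> 'p sig \<Rightarrow> 'p ctx \<Rightarrow> 'p obj \<Rightarrow> 'p fam \<Rightarrow> bool"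


text \<open>Shifting: every index pointing outside the \<open>k\<close> innermost binders is incremented.\<close>

primrec lift_fam :: "nat \<Rightarrow> 'p fam \<Rightarrow> 'p fam"
  and lift_obj :: "nat \<Rightarrow> 'p obj \<Rightarrow> 'p obj" where
  "lift_fam k (FConst a) = FConst a"
| "lift_fam k (FPi \<sigma> \<tau>) = FPi (lift_fam k \<sigma>) (lift_fam (Suc k) \<tau>)"
| "lift_fam k (FApp \<sigma> N) = FApp (lift_fam k \<sigma>) (lift_obj k N)"
| "lift_fam k (FLock P N \<sigma> \<rho>) = FLock P (lift_obj k N) (lift_fam k \<sigma>) (lift_fam k \<rho>)"
| "lift_obj k (OConst c) = OConst c"
| "lift_obj k (Free x) = Free x"
| "lift_obj k (Bound i) = Bound (if i < k then i else Suc i)"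
| "lift_obj k (Lam \<sigma> M) = Lam (lift_fam k \<sigma>) (lift_obj (Suc k) M)"
| "lift_obj k (OApp M N) = OApp (lift_obj k M) (lift_obj k N)"
| "lift_obj k (OLock P N \<sigma> M) = OLock P (lift_obj k N) (lift_fam k \<sigma>) (lift_obj k M)"
| "lift_obj k (OUnlock P N \<sigma> M) = OUnlock P (lift_obj k N) (lift_fam k \<sigma>) (lift_obj k M)"

text \<open>\<open>bind_fam k x\<close> and its companions turn the named variable \<open>x\<close> into the index \<open>k\<close>, so that
  \<open>\<Pi>x:\<sigma>. \<tau>\<close> is \<open>FPi \<sigma> (bind_fam 0 x \<tau>)\<close>.\<close>

primrec bind_fam :: "nat \<Rightarrow> name \<Rightarrow> 'p fam \<Rightarrow> 'p fam"
  and bind_obj :: "nat \<Rightarrow> name \<Rightarrow> 'p obj \<Rightarrow> 'p obj" where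
  "bind_fam k x (FConst a) = FConst a"
| "bind_fam k x (FPi \<sigma> \<tau>) = FPi (bind_fam k x \<sigma>) (bind_fam (Suc k) x \<tau>)"
| "bind_fam k x (FApp \<sigma> N) = FApp (bind_fam k x \<sigma>) (bind_obj k x N)"
| "bind_fam k x (FLock P N \<sigma> \<rho>) = FLock P (bind_obj k x N) (bind_fam k x \<sigma>) (bind_fam k x \<rho>)"
| "bind_obj k x (OConst c) = OConst c"
| "bind_obj k x (Free y) = (if y = x then Bound k else Free y)"
| "bind_obj k x (Bound i) = Bound (if i < k then i else Suc i)"
| "bind_obj k x (Lam \<sigma> M) = Lam (bind_fam k x \<sigma>) (bind_obj (Suc k) x M)"
| "bind_obj k x (OApp M N) = OApp (bind_obj k x M) (bind_obj k x N)"
| "bind_obj k x (OLock P N \<sigma> M) = OLock P (bind_obj k x N) (bind_fam k x \<sigma>) (bind_obj k x M)"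
| "bind_obj k x (OUnlock P N \<sigma> M) =
     OUnlock P (bind_obj k x N) (bind_fam k x \<sigma>) (bind_obj k x M)"

primrec bind_kind :: "nat \<Rightarrow> name \<Rightarrow> 'p kind \<Rightarrow> 'p kind" where
  "bind_kind k x Type = Type"
| "bind_kind k x (KPi \<sigma> K) = KPi (bind_fam k x \<sigma>) (bind_kind (Suc k) x K)"

text \<open>Instantiation of the index \<open>k\<close>, whose binder disappears, by an object \<open>L\<close>.\<close>

primrec inst_fam :: "nat \<Rightarrow> 'p obj \<Rightarrow> 'p fam \<Rightarrow> 'p fam"
  and inst_obj :: "nat \<Rightarrow> 'p obj \<Rightarrow> 'p obj \<Rightarrow> 'p obj" where
  "inst_fam k L (FConst a) = FConst a"
| "inst_fam k L (FPi \<sigma> \<tau>) = FPi (inst_fam k L \<sigma>) (inst_fam (Suc k) (lift_obj 0 L) \<tau>)"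
| "inst_fam k L (FApp \<sigma> N) = FApp (inst_fam k L \<sigma>) (inst_obj k L N)"
| "inst_fam k L (FLock P N \<sigma> \<rho>) = FLock P (inst_obj k L N) (inst_fam k L \<sigma>) (inst_fam k L \<rho>)"
| "inst_obj k L (OConst c) = OConst c"
| "inst_obj k L (Free x) = Free x"
| "inst_obj k L (Bound i) = (if i < k then Bound i else if i = k then L else Bound (i - 1))"
| "inst_obj k L (Lam \<sigma> M) = Lam (inst_fam k L \<sigma>) (inst_obj (Suc k) (lift_obj 0 L) M)"
| "inst_obj k L (OApp M N) = OApp (inst_obj k L M) (inst_obj k L N)"
| "inst_obj k L (OLock P N \<sigma> M) = OLock P (inst_obj k L N) (inst_fam k L \<sigma>) (inst_obj k L M)"
| "inst_obj k L (OUnlock P N \<sigma> M) =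
     OUnlock P (inst_obj k L N) (inst_fam k L \<sigma>) (inst_obj k L M)"

primrec inst_kind :: "nat \<Rightarrow> 'p obj \<Rightarrow> 'p kind \<Rightarrow> 'p kind" where
  "inst_kind k L Type = Type"
| "inst_kind k L (KPi \<sigma> K) = KPi (inst_fam k L \<sigma>) (inst_kind (Suc k) (lift_obj 0 L) K)"

text \<open>Capture-avoiding substitution for a named variable: \<open>subst_obj x N M\<close> is \<open>M[N/x]\<close>.\<close>

definition subst_fam :: "name \<Rightarrow> 'p obj \<Rightarrow> 'p fam \<Rightarrow> 'p fam" where
  "subst_fam x N \<rho> = inst_fam 0 N (bind_fam 0 x \<rho>)"

definition subst_obj :: "name \<Rightarrow> 'p obj \<Rightarrow> 'p obj \<Rightarrow> 'p obj" where
  "subst_obj x N M = inst_obj 0 N (bind_obj 0 x M)"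


inductive red_fam :: "'p fam \<Rightarrow> 'p fam \<Rightarrow> bool"
  and red_obj :: "'p obj \<Rightarrow> 'p obj \<Rightarrow> bool" where
  beta: "red_obj (OApp (Lam \<sigma> M) N) (inst_obj 0 N M)"
| unlock_lock: "red_obj (OUnlock P N \<sigma> (OLock P N \<sigma> M)) M"
| red_FPi1: "red_fam \<sigma> \<sigma>' \<Longrightarrow> red_fam (FPi \<sigma> \<tau>) (FPi \<sigma>' \<tau>)"
| red_FPi2: "red_fam \<tau> \<tau>' \<Longrightarrow> red_fam (FPi \<sigma> \<tau>) (FPi \<sigma> \<tau>')"
| red_FApp1: "red_fam \<sigma> \<sigma>' \<Longrightarrow> red_fam (FApp \<sigma> N) (FApp \<sigma>' N)"
| red_FApp2: "red_obj N N' \<Longrightarrow> red_fam (FApp \<sigma> N) (FApp \<sigma> N')"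
| red_FLock1: "red_obj N N' \<Longrightarrow> red_fam (FLock P N \<sigma> \<rho>) (FLock P N' \<sigma> \<rho>)"
| red_FLock2: "red_fam \<sigma> \<sigma>' \<Longrightarrow> red_fam (FLock P N \<sigma> \<rho>) (FLock P N \<sigma>' \<rho>)"
| red_FLock3: "red_fam \<rho> \<rho>' \<Longrightarrow> red_fam (FLock P N \<sigma> \<rho>) (FLock P N \<sigma> \<rho>')"
| red_Lam1: "red_fam \<sigma> \<sigma>' \<Longrightarrow> red_obj (Lam \<sigma> M) (Lam \<sigma>' M)"
| red_Lam2: "red_obj M M' \<Longrightarrow> red_obj (Lam \<sigma> M) (Lam \<sigma> M')"
| red_OApp1: "red_obj M M' \<Longrightarrow> red_obj (OApp M N) (OApp M' N)"
| red_OApp2: "red_obj N N' \<Longrightarrow> red_obj (OApp M N) (OApp M N')"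
| red_OLock1: "red_obj N N' \<Longrightarrow> red_obj (OLock P N \<sigma> M) (OLock P N' \<sigma> M)"
| red_OLock2: "red_fam \<sigma> \<sigma>' \<Longrightarrow> red_obj (OLock P N \<sigma> M) (OLock P N \<sigma>' M)"
| red_OLock3: "red_obj M M' \<Longrightarrow> red_obj (OLock P N \<sigma> M) (OLock P N \<sigma> M')"
| red_OUnlock1: "red_obj N N' \<Longrightarrow> red_obj (OUnlock P N \<sigma> M) (OUnlock P N' \<sigma> M)"
| red_OUnlock2: "red_fam \<sigma> \<sigma>' \<Longrightarrow> red_obj (OUnlock P N \<sigma> M) (OUnlock P N \<sigma>' M)"
| red_OUnlock3: "red_obj M M' \<Longrightarrow> red_obj (OUnlock P N \<sigma> M) (OUnlock P N \<sigma> M')"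

inductive red_kind :: "'p kind \<Rightarrow> 'p kind \<Rightarrow> bool" where
  red_KPi1: "red_fam \<sigma> \<sigma>' \<Longrightarrow> red_kind (KPi \<sigma> K) (KPi \<sigma>' K)"
| red_KPi2: "red_kind K K' \<Longrightarrow> red_kind (KPi \<sigma> K) (KPi \<sigma> K')"

abbreviation eq_fam :: "'p fam \<Rightarrow> 'p fam \<Rightarrow> bool" where "eq_fam \<equiv> equivclp red_fam"
abbreviation eq_obj :: "'p obj \<Rightarrow> 'p obj \<Rightarrow> bool" where "eq_obj \<equiv> equivclp red_obj"
abbreviation eq_kind :: "'p kind \<Rightarrow> 'p kind \<Rightarrow> bool" where "eq_kind \<equiv> equivclp red_kind"


text \<open>The five judgements \<open>\<Sigma> sig\<close>, \<open>\<turnstile>\<^sub>\<Sigma> \<Gamma>\<close>, \<open>\<Gamma> \<turnstile>\<^sub>\<Sigma> K\<close>, \<open>\<Gamma> \<turnstile>\<^sub>\<Sigma> \<sigma> : K\<close> and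
  \<open>\<Gamma> \<turnstile>\<^sub>\<Sigma> M : \<sigma>\<close>, relative to an interpretation \<open>I\<close> of the predicates.\<close>

inductive sig_ok :: "'p interp \<Rightarrow> 'p sig \<Rightarrow> bool"
  and ctx_ok :: "'p interp \<Rightarrow> 'p sig \<Rightarrow> 'p ctx \<Rightarrow> bool"
  and kind_ok :: "'p interp \<Rightarrow> 'p sig \<Rightarrow> 'p ctx \<Rightarrow> 'p kind \<Rightarrow> bool"
  and fam_typing :: "'p interp \<Rightarrow> 'p sig \<Rightarrow> 'p ctx \<Rightarrow> 'p fam \<Rightarrow> 'p kind \<Rightarrow> bool"
  and obj_typing :: "'p interp \<Rightarrow> 'p sig \<Rightarrow> 'p ctx \<Rightarrow> 'p obj \<Rightarrow> 'p fam \<Rightarrow> bool"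
  for I :: "'p interp" where
  S_Empty: "sig_ok I []"
| S_Kind: "\<lbrakk>kind_ok I \<Sigma> [] K; a \<notin> sig_dom \<Sigma>\<rbrakk> \<Longrightarrow> sig_ok I (FDecl a K # \<Sigma>)"
| S_Type: "\<lbrakk>fam_typing I \<Sigma> [] \<sigma> Type; c \<notin> sig_dom \<Sigma>\<rbrakk> \<Longrightarrow> sig_ok I (ODecl c \<sigma> # \<Sigma>)"

| C_Empty: "sig_ok I \<Sigma> \<Longrightarrow> ctx_ok I \<Sigma> []"
| C_Type: "\<lbrakk>fam_typing I \<Sigma> \<Gamma> \<sigma> Type; x \<notin> ctx_dom \<Gamma>\<rbrakk> \<Longrightarrow> ctx_ok I \<Sigma> ((x, \<sigma>) # \<Gamma>)"

| K_Type: "ctx_ok I \<Sigma> \<Gamma> \<Longrightarrow> kind_ok I \<Sigma> \<Gamma> Type"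
| K_Pi: "kind_ok I \<Sigma> ((x, \<sigma>) # \<Gamma>) K \<Longrightarrow> kind_ok I \<Sigma> \<Gamma> (KPi \<sigma> (bind_kind 0 x K))"

| F_Const: "\<lbrakk>ctx_ok I \<Sigma> \<Gamma>; FDecl a K \<in> set \<Sigma>\<rbrakk> \<Longrightarrow> fam_typing I \<Sigma> \<Gamma> (FConst a) K"
| F_Pi: "fam_typing I \<Sigma> ((x, \<sigma>) # \<Gamma>) \<tau> Type
    \<Longrightarrow> fam_typing I \<Sigma> \<Gamma> (FPi \<sigma> (bind_fam 0 x \<tau>)) Type"
| F_App: "\<lbrakk>fam_typing I \<Sigma> \<Gamma> \<sigma> (KPi \<tau> K); obj_typing I \<Sigma> \<Gamma> N \<tau>\<rbrakk>
    \<Longrightarrow> fam_typing I \<Sigma> \<Gamma> (FApp \<sigma> N) (inst_kind 0 N K)"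
| F_Lock: "\<lbrakk>fam_typing I \<Sigma> \<Gamma> \<rho> Type; obj_typing I \<Sigma> \<Gamma> N \<sigma>\<rbrakk>
    \<Longrightarrow> fam_typing I \<Sigma> \<Gamma> (FLock P N \<sigma> \<rho>) Type"
| F_Conv: "\<lbrakk>fam_typing I \<Sigma> \<Gamma> \<sigma> K; kind_ok I \<Sigma> \<Gamma> K'; eq_kind K K'\<rbrakk>
    \<Longrightarrow> fam_typing I \<Sigma> \<Gamma> \<sigma> K'"
| F_Guarded_Unlock:
    "\<lbrakk>fam_typing I \<Sigma> ((x, \<tau>) # \<Gamma>) (FLock P S \<sigma> \<rho>) Type;
      obj_typing I \<Sigma> \<Gamma> N (FLock P S' \<sigma>' \<tau>); eq_fam \<sigma> \<sigma>'; eq_obj S S'\<rbrakk>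
    \<Longrightarrow> fam_typing I \<Sigma> \<Gamma> (FLock P S \<sigma> (subst_fam x (OUnlock P S' \<sigma>' N) \<rho>)) Type"

| O_Const: "\<lbrakk>ctx_ok I \<Sigma> \<Gamma>; ODecl c \<sigma> \<in> set \<Sigma>\<rbrakk> \<Longrightarrow> obj_typing I \<Sigma> \<Gamma> (OConst c) \<sigma>"
| O_Var: "\<lbrakk>ctx_ok I \<Sigma> \<Gamma>; (x, \<sigma>) \<in> set \<Gamma>\<rbrakk> \<Longrightarrow> obj_typing I \<Sigma> \<Gamma> (Free x) \<sigma>"
| O_Abs: "obj_typing I \<Sigma> ((x, \<sigma>) # \<Gamma>) M \<tau>
    \<Longrightarrow> obj_typing I \<Sigma> \<Gamma> (Lam \<sigma> (bind_obj 0 x M)) (FPi \<sigma> (bind_fam 0 x \<tau>))"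
| O_App: "\<lbrakk>obj_typing I \<Sigma> \<Gamma> M (FPi \<sigma> \<tau>); obj_typing I \<Sigma> \<Gamma> N \<sigma>\<rbrakk>
    \<Longrightarrow> obj_typing I \<Sigma> \<Gamma> (OApp M N) (inst_fam 0 N \<tau>)"
| O_Conv: "\<lbrakk>obj_typing I \<Sigma> \<Gamma> M \<sigma>; fam_typing I \<Sigma> \<Gamma> \<tau> Type; eq_fam \<sigma> \<tau>\<rbrakk>
    \<Longrightarrow> obj_typing I \<Sigma> \<Gamma> M \<tau>"
| O_Lock: "\<lbrakk>obj_typing I \<Sigma> \<Gamma> M \<rho>; obj_typing I \<Sigma> \<Gamma> N \<sigma>\<rbrakk>
    \<Longrightarrow> obj_typing I \<Sigma> \<Gamma> (OLock P N \<sigma> M) (FLock P N \<sigma> \<rho>)"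
| O_Top_Unlock: "\<lbrakk>obj_typing I \<Sigma> \<Gamma> M (FLock P N \<sigma> \<rho>); I P \<Sigma> \<Gamma> N \<sigma>\<rbrakk>
    \<Longrightarrow> obj_typing I \<Sigma> \<Gamma> (OUnlock P N \<sigma> M) \<rho>"
| O_Guarded_Unlock:
    "\<lbrakk>obj_typing I \<Sigma> ((x, \<tau>) # \<Gamma>) (OLock P S \<sigma> M) (FLock P S \<sigma> \<rho>);
      obj_typing I \<Sigma> \<Gamma> N (FLock P S' \<sigma>' \<tau>); eq_fam \<sigma> \<sigma>'; eq_obj S S'\<rbrakk>
    \<Longrightarrow> obj_typing I \<Sigma> \<Gamma> (OLock P S \<sigma> (subst_obj x (OUnlock P S' \<sigma>' N) M))
          (FLock P S \<sigma> (subst_fam x (OUnlock P S' \<sigma>' N) \<rho>))"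

end

theory Submission
  imports Defs
begin

text \<open>Induction on the derivation: only \<open>O_Top_Unlock\<close> introduces an unlock as
  subject, and its premise is the claim; \<open>O_Conv\<close> changes only the type. In
  \<open>O_Guarded_Unlock\<close> the new unlock lies under a lock.\<close>

lemma obj_typing_OUnlock_imp_interp:
  "obj_typing I \<Sigma> \<Gamma> L \<tau> \<Longrightarrow> \<forall>P N \<sigma> M. L = OUnlock P N \<sigma> M \<longrightarrow> I P \<Sigma> \<Gamma> N \<sigma>"
  by (erule sig_ok_ctx_ok_kind_ok_fam_typing_obj_typing.inducts(5)
      \<comment> \<open>The induction is mutual; only object typing carries a claim, so the other
        four judgements get \<open>True\<close>.\<close>
      [where ?P1.0 = "\<lambda>_. True" and ?P2.0 = "\<lambda>_ _. True"
        and ?P3.0 = "\<lambda>_ _ _. True" and ?P4.0 = "\<lambda>_ _ _ _. True"]) simp_all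

theorem theorem4p7:
  fixes I :: "'p interp" and P :: 'p and \<Sigma> :: "'p sig" and \<Gamma> :: "'p ctx"
    and N M :: "'p obj" and \<sigma> \<tau> :: "'p fam"
  assumes "obj_typing I \<Sigma> \<Gamma> (OUnlock P N \<sigma> M) \<tau>"
  shows "I P \<Sigma> \<Gamma> N \<sigma>"
  using obj_typing_OUnlock_imp_interp[OF assms] by simp

end
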